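(* There are infinitely many pairs of finite connected graphs $G\subseteq H$ on the same vertex set (i.e. $H$ is obtained from $G$ by adding edges) such that $G$ is stackable but $H$ is not stackable.
   Context: Cup stacking on a finite connected graph: initially one cup on every vertex; a move takes all $r\ge1$ cups from a vertex $x$ onto a vertex $y\neq x$ that already carries at least one cup and satisfies $d(x,y)=r$ (shortest-path distance). A graph is $t$-stackable if some sequence of moves ends with all cups on $t$, and stackable if it is $t$-stackable for every vertex $t$. *)

theory Defs
  imports "Graph_Theory.Graph_Theory"
begin

text \<open>Only meaningful when \<^term>\<open>y\<close> is reachable from \<^term>\<open>x\<close>, as in a connected graph.\<close>

definition graph_dist :: "'a pair_pre_digraph \<Rightarrow> 'a \<Rightarrow> 'a \<Rightarrow> nat" where
  "graph_dist G x y = (LEAST k. \<exists>p. pre_digraph.awalk (with_proj G) x p y \<and> length p = k)"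

text \<open>A configuration \<^term>\<open>c\<close> assigns to every vertex the number of cups on it; it is 0 off the graph.\<close>

definition initial_cups :: "'a pair_pre_digraph \<Rightarrow> 'a \<Rightarrow> nat" where
  "initial_cups G = (\<lambda>v. if v \<in> pverts G then 1 else 0)"

definition cup_move :: "'a pair_pre_digraph \<Rightarrow> ('a \<Rightarrow> nat) \<Rightarrow> ('a \<Rightarrow> nat) \<Rightarrow> bool" where
  "cup_move G c c' \<longleftrightarrow>
     (\<exists>x \<in> pverts G. \<exists>y \<in> pverts G. x \<noteq> y \<and> c x \<ge> 1 \<and> c y \<ge> 1 \<and>
        graph_dist G x y = c x \<and> c' = c(x := 0, y := c y + c x))"

definition stackable_at :: "'a pair_pre_digraph \<Rightarrow> 'a \<Rightarrow> bool" where
  "stackable_at G t \<longleftrightarrow> (\<exists>c. (cup_move G)\<^sup>*\<^sup>* (initial_cups G) c \<and> (\<forall>v. v \<noteq> t \<longrightarrow> c v = 0))"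

definition stackable :: "'a pair_pre_digraph \<Rightarrow> bool" where
  "stackable G \<longleftrightarrow> (\<forall>t \<in> pverts G. stackable_at G t)"

text \<open>
  Isomorphism of pairs consisting of a graph and a spanning subgraph: one isomorphism
  of the larger graphs that also carries the subgraphs onto each other.
\<close>

definition graph_pair_iso ::
  "(('a pair_pre_digraph \<times> 'a pair_pre_digraph) \<times> ('a pair_pre_digraph \<times> 'a pair_pre_digraph)) set"
  where
  "graph_pair_iso = {((G, H), (G', H')).
     spanning (with_proj G) (with_proj H) \<and> spanning (with_proj G') (with_proj H') \<and>
     (\<exists>f. pre_digraph.digraph_isomorphism (with_proj H) f \<and>
          with_proj H' = app_iso f (with_proj H) \<and> with_proj G' = app_iso f (with_proj G))}"

lemma equiv_graph_pair_iso:
  "equiv {(G, H). spanning (with_proj G) (with_proj H)}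
     (graph_pair_iso :: (('a pair_pre_digraph \<times> 'a pair_pre_digraph) \<times> _) set)"
proof (rule equivI)
  show "graph_pair_iso \<subseteq> {(G, H :: 'a pair_pre_digraph). spanning (with_proj G) (with_proj H)} \<times>
     {(G, H). spanning (with_proj G) (with_proj H)}"
    by (auto simp: graph_pair_iso_def)
next
  show "refl_on {(G, H). spanning (with_proj G) (with_proj H)}
     (graph_pair_iso :: (('a pair_pre_digraph \<times> 'a pair_pre_digraph) \<times> _) set)"
  proof (rule refl_onI, clarify)
    fix G H :: "'a pair_pre_digraph"
    assume *: "spanning (with_proj G) (with_proj H)"
    let ?f = "\<lparr>iso_verts = id, iso_arcs = id, iso_head = snd, iso_tail = fst\<rparr>"
    have "pre_digraph.digraph_isomorphism (with_proj H) ?f"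
      using * by (simp add: pre_digraph.digraph_isomorphism_def spanning_def subgraph_def)
    moreover have "with_proj H = app_iso ?f (with_proj H)" "with_proj G = app_iso ?f (with_proj G)"
      by (simp_all add: app_iso_def with_proj_def)
    ultimately show "((G, H), (G, H)) \<in> graph_pair_iso"
      using * unfolding graph_pair_iso_def by blast
  qed
next
  show "sym (graph_pair_iso :: (('a pair_pre_digraph \<times> 'a pair_pre_digraph) \<times> _) set)"
  proof (rule symI, clarify)
    fix G H G' H' :: "'a pair_pre_digraph"
    assume "((G, H), (G', H')) \<in> graph_pair_iso"
    then obtain f where s: "spanning (with_proj G) (with_proj H)" "spanning (with_proj G') (with_proj H')"
      and f: "pre_digraph.digraph_isomorphism (with_proj H) f"
      and H': "with_proj H' = app_iso f (with_proj H)" and G': "with_proj G' = app_iso f (with_proj G)"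
      by (auto simp: graph_pair_iso_def)
    let ?g = "pre_digraph.inv_iso (with_proj H) f"
    have wf: "wf_digraph (with_proj H)" using s by (simp add: spanning_def subgraph_def)
    have sub: "pverts G = pverts H" "parcs G \<subseteq> parcs H"
      using s by (auto simp: spanning_def subgraph_def)
    have "pre_digraph.digraph_isomorphism (with_proj H') ?g"
      unfolding H' by (rule wf_digraph.digraph_isomorphism_invI[OF wf f])
    moreover have "with_proj H = app_iso ?g (with_proj H')"
      unfolding H' by (simp add: pre_digraph.app_iso_inv[OF f])
    moreover have "with_proj G = app_iso ?g (with_proj G')"
    proof -
      have inj: "inj_on (iso_verts f) (pverts H)" "inj_on (iso_arcs f) (parcs H)"
        using f by (auto simp: pre_digraph.digraph_isomorphism_def)
      have "the_inv_into (pverts H) (iso_verts f) ` iso_verts f ` pverts H = pverts H"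
        by (auto simp: image_image the_inv_into_f_f[OF inj(1)])
      moreover have "the_inv_into (parcs H) (iso_arcs f) ` iso_arcs f ` parcs G = parcs G"
        using sub(2) by (force simp: image_image the_inv_into_f_f[OF inj(2)])
      ultimately show ?thesis
        unfolding G' by (simp add: app_iso_def pre_digraph.inv_iso_def with_proj_def sub(1))
    qed
    ultimately show "((G', H'), (G, H)) \<in> graph_pair_iso"
      using s unfolding graph_pair_iso_def by blast
  qed
next
  show "trans (graph_pair_iso :: (('a pair_pre_digraph \<times> 'a pair_pre_digraph) \<times> _) set)"
  proof (rule transI, clarify)
    fix G H G' H' G'' H'' :: "'a pair_pre_digraph"
    assume "((G, H), (G', H')) \<in> graph_pair_iso" "((G', H'), (G'', H'')) \<in> graph_pair_iso"
    then obtain f g where s: "spanning (with_proj G) (with_proj H)" "spanning (with_proj G'') (with_proj H'')"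
      and f: "pre_digraph.digraph_isomorphism (with_proj H) f"
      and g: "pre_digraph.digraph_isomorphism (with_proj H') g"
      and H': "with_proj H' = app_iso f (with_proj H)" and G': "with_proj G' = app_iso f (with_proj G)"
      and H'': "with_proj H'' = app_iso g (with_proj H')" and G'': "with_proj G'' = app_iso g (with_proj G')"
      by (auto simp: graph_pair_iso_def)
    have "pre_digraph.digraph_isomorphism (with_proj H) (o_iso g f)"
      using f g unfolding H' pre_digraph.digraph_isomorphism_def
      by (auto simp: o_iso_def intro: comp_inj_on)
    moreover have "with_proj H'' = app_iso (o_iso g f) (with_proj H)"
      "with_proj G'' = app_iso (o_iso g f) (with_proj G)"
      unfolding H'' H' G'' G' by (simp_all add: app_iso_def o_iso_def image_comp)
    ultimately show "((G, H), (G'', H'')) \<in> graph_pair_iso"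
      using s unfolding graph_pair_iso_def by blast
  qed
qed

end

theory Submission
  imports Defs
begin

text \<open>
  Take a pentagon 0, h, i, 2, 3, a triangle 0, h, 4 on its edge from 0 to h, and pendant vertices
  1 at 0 and 5 at h. This graph is stackable at each of its eight vertices. Now duplicate the
  adjacent pair (h, i) arbitrarily often: every vertex outside a pair has distance 2 from
  one of the two vertices of the pair, so the two cups of a superfluous pair can be joined and
  moved onto the target in one further move. Hence all these graphs G are stackable.

  Let H arise from G by joining 0 to all vertices. In H all distances are at most 2, vertex 1 is
  pendant at 0, and the vertices other than 0, 2 and the h's form an independent set. To
  reach vertex 1, all vertices except 1 and at most 0 must be paired up along edges, which is
  impossible because, apart from vertex 1, the independent set has one vertex more than its
  complement.
\<close>

section \<open>Distances\<close>

text \<open>This is the predicate under \<open>LEAST\<close> in \<open>graph_dist\<close>. With a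
  name of its own it admits a recursion on the length, so that small distances follow from arcs
  alone.\<close>

definition walk_of_length :: "'a pair_pre_digraph \<Rightarrow> nat \<Rightarrow> 'a \<Rightarrow> 'a \<Rightarrow> bool" where
  "walk_of_length G k x y \<longleftrightarrow> (\<exists>p. pre_digraph.awalk (with_proj G) x p y \<and> length p = k)"

lemma graph_dist_eq_Least: "graph_dist G x y = (LEAST k. walk_of_length G k x y)"
  by (simp add: graph_dist_def walk_of_length_def)

lemma walk_of_length_0: "walk_of_length G 0 x y \<longleftrightarrow> x = y \<and> x \<in> pverts G"
  by (auto simp: walk_of_length_def pre_digraph.awalk_def pre_digraph.cas.simps)

context pair_wf_digraph
begin

lemma walk_of_length_Suc:
  "walk_of_length G (Suc k) x y \<longleftrightarrow> (\<exists>z. (x, z) \<in> parcs G \<and> walk_of_length G k z y)"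
proof
  assume "walk_of_length G (Suc k) x y"
  then obtain a p where "awalk x (a # p) y" "length p = k"
    by (auto simp: walk_of_length_def length_Suc_conv)
  then show "\<exists>z. (x, z) \<in> parcs G \<and> walk_of_length G k z y"
    by (cases a) (auto simp: awalk_Cons_iff walk_of_length_def)
next
  assume "\<exists>z. (x, z) \<in> parcs G \<and> walk_of_length G k z y"
  then obtain z p where "(x, z) \<in> parcs G" "awalk z p y" "length p = k"
    by (auto simp: walk_of_length_def)
  then have "awalk x ((x, z) # p) y \<and> length ((x, z) # p) = Suc k"
    by (simp add: awalk_Cons_iff)
  then show "walk_of_length G (Suc k) x y"
    unfolding walk_of_length_def by blast
qed

lemma walk_of_length_1: "walk_of_length G (Suc 0) x y \<longleftrightarrow> (x, y) \<in> parcs G"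
  by (auto simp: walk_of_length_Suc walk_of_length_0 dest: wellformed')

lemma graph_dist_le: "walk_of_length G k x y \<Longrightarrow> graph_dist G x y \<le> k"
  unfolding graph_dist_eq_Least by (rule Least_le)

lemma walk_of_length_graph_dist:
  "walk_of_length G k x y \<Longrightarrow> walk_of_length G (graph_dist G x y) x y"
  unfolding graph_dist_eq_Least by (rule LeastI)

lemma graph_dist_eqI:
  assumes "walk_of_length G k x y" "\<And>l. l < k \<Longrightarrow> \<not> walk_of_length G l x y"
  shows "graph_dist G x y = k"
  unfolding graph_dist_eq_Least
proof (rule Least_equality)
  show "k \<le> l" if "walk_of_length G l x y" for l
    using assms(2) that not_less by blast
qed (fact assms(1))

lemma graph_dist_1I: "(x, y) \<in> parcs G \<Longrightarrow> x \<noteq> y \<Longrightarrow> graph_dist G x y = 1"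
  by (rule graph_dist_eqI) (auto simp: walk_of_length_0 walk_of_length_1)

lemma graph_dist_2I:
  assumes "(x, z) \<in> parcs G" "(z, y) \<in> parcs G" "x \<noteq> y" "(x, y) \<notin> parcs G"
  shows "graph_dist G x y = 2"
proof (rule graph_dist_eqI)
  show "walk_of_length G 2 x y"
    using assms by (auto simp: numeral_2_eq_2 walk_of_length_Suc[of "Suc 0"] walk_of_length_1)
  show "\<not> walk_of_length G l x y" if "l < 2" for l
    using that assms by (auto simp: less_2_cases_iff walk_of_length_0 walk_of_length_1)
qed

lemma graph_dist_3I:
  assumes "(x, u) \<in> parcs G" "(u, v) \<in> parcs G" "(v, y) \<in> parcs G"
    and "x \<noteq> y" "(x, y) \<notin> parcs G" "\<And>z. (x, z) \<in> parcs G \<Longrightarrow> (z, y) \<notin> parcs G"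
  shows "graph_dist G x y = 3"
proof (rule graph_dist_eqI)
  show "walk_of_length G 3 x y"
    using assms(1-3)
    by (auto simp: numeral_3_eq_3 walk_of_length_Suc[of "Suc _"] walk_of_length_1)
  show "\<not> walk_of_length G l x y" if "l < 3" for l
  proof -
    from that have "l = 0 \<or> l = Suc 0 \<or> l = Suc (Suc 0)" by linarith
    then show ?thesis
      using assms(4-6)
      by (auto simp: walk_of_length_0 walk_of_length_1 walk_of_length_Suc[of "Suc 0"])
  qed
qed

end

section \<open>Gathering disjoint sets of cups\<close>

text \<open>
  Starting with one cup on each vertex of \<open>S\<close>, the \<open>n\<close> cups on \<open>S\<close> can be
  stacked on \<open>v\<close> without using any vertex outside \<open>S\<close>. Moves on disjoint sets do not interfere,
  so no configurations need to be tracked.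
\<close>

inductive gathers :: "'a pair_pre_digraph \<Rightarrow> 'a set \<Rightarrow> nat \<Rightarrow> 'a \<Rightarrow> bool" for G where
  single: "v \<in> pverts G \<Longrightarrow> gathers G {v} 1 v"
| merge: "gathers G S k x \<Longrightarrow> gathers G T l y \<Longrightarrow> S \<inter> T = {} \<Longrightarrow> graph_dist G x y = k \<Longrightarrow>
    gathers G (S \<union> T) (k + l) y"

lemma gathers_cup_moves:
  assumes "gathers G S n v"
  shows "S \<subseteq> pverts G \<and> v \<in> S \<and> n \<ge> 1 \<and>
    (\<forall>c. (\<forall>u\<in>S. c u = 1) \<longrightarrow>
      (cup_move G)\<^sup>*\<^sup>* c (\<lambda>u. if u = v then n else if u \<in> S then 0 else c u))"
  using assms
proof induction
  case (single v)
  have "(cup_move G)\<^sup>*\<^sup>* c (\<lambda>u. if u = v then 1 else if u \<in> {v} then 0 else c u)"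
    if "\<forall>u\<in>{v}. c u = 1" for c
  proof -
    from that have "(\<lambda>u. if u = v then 1 else if u \<in> {v} then 0 else c u) = c"
      by auto
    then show ?thesis by simp
  qed
  with single show ?case by auto
next
  case (merge S k x T l y)
  then have ST: "S \<subseteq> pverts G" "T \<subseteq> pverts G" "x \<in> S" "y \<in> T" "k \<ge> 1" "l \<ge> 1"
    by simp_all
  have "(cup_move G)\<^sup>*\<^sup>* c (\<lambda>u. if u = y then k + l else if u \<in> S \<union> T then 0 else c u)"
    if c: "\<forall>u\<in>S \<union> T. c u = 1" for c
  proof -
    \<comment> \<open>\<open>d\<close> is reached after the moves on \<open>S\<close>, and
      \<open>e\<close> after those on \<open>T\<close>.\<close>
    define d where "d = (\<lambda>u. if u = x then k else if u \<in> S then 0 else c u)"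
    define e where "e = (\<lambda>u. if u = y then l else if u \<in> T then 0 else d u)"
    have "x \<notin> T" "y \<notin> S" "x \<noteq> y"
      using ST merge.hyps by auto
    have "\<forall>u\<in>S. c u = 1"
      using c by simp
    with merge.IH(1) have "(cup_move G)\<^sup>*\<^sup>* c d"
      unfolding d_def by simp
    moreover have "\<forall>u\<in>T. d u = 1"
      using c merge.hyps \<open>x \<notin> T\<close> by (auto simp: d_def)
    with merge.IH(2) have "(cup_move G)\<^sup>*\<^sup>* d e"
      unfolding e_def by simp
    moreover have "cup_move G e (e(x := 0, y := e y + e x))"
    proof -
      have "e x = k" "e y = l"
        using \<open>x \<noteq> y\<close> \<open>x \<notin> T\<close> by (simp_all add: d_def e_def)
      then show ?thesis
        unfolding cup_move_def using ST merge.hyps \<open>x \<noteq> y\<close>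
        by (intro bexI[of _ x] bexI[of _ y]) auto
    qed
    moreover have "e(x := 0, y := e y + e x) =
        (\<lambda>u. if u = y then k + l else if u \<in> S \<union> T then 0 else c u)"
    proof
      fix u
      show "(e(x := 0, y := e y + e x)) u =
          (if u = y then k + l else if u \<in> S \<union> T then 0 else c u)"
        using ST(3,4) \<open>x \<noteq> y\<close> \<open>x \<notin> T\<close> \<open>y \<notin> S\<close> by (simp add: d_def e_def)
    qed
    ultimately show ?thesis
      by (metis rtranclp.rtrancl_into_rtrancl rtranclp_trans)
  qed
  with ST show ?case by simp
qed

lemma stackable_at_if_gathers:
  assumes "gathers G (pverts G) n v"
  shows "stackable_at G v"
proof -
  have "(cup_move G)\<^sup>*\<^sup>* (initial_cups G)
      (\<lambda>u. if u = v then n else if u \<in> pverts G then 0 else initial_cups G u)"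
    using gathers_cup_moves[OF assms] by (metis initial_cups_def)
  then show ?thesis
    unfolding stackable_at_def by (intro exI conjI) (auto simp: initial_cups_def)
qed

section \<open>The graphs\<close>

text \<open>The pairs (h, i) of the construction are the pairs (6, 7), (8, 9), \<dots>.\<close>

definition half_edge :: "nat \<Rightarrow> nat \<Rightarrow> bool" where
  "half_edge u v \<longleftrightarrow>
     u = 0 \<and> (v = 1 \<or> v = 3 \<or> v = 4 \<or> 6 \<le> v \<and> even v) \<or>
     u = 2 \<and> (v = 3 \<or> 6 \<le> v \<and> odd v) \<or>
     6 \<le> u \<and> even u \<and> (v = 4 \<or> v = 5 \<or> v = Suc u)"

definition sparse_graph :: "nat \<Rightarrow> nat pair_pre_digraph" where
  "sparse_graph m = \<lparr>pverts = {..<6 + 2 * m},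
     parcs = {(u, v). u < 6 + 2 * m \<and> v < 6 + 2 * m \<and> (half_edge u v \<or> half_edge v u)}\<rparr>"

definition dense_graph :: "nat \<Rightarrow> nat pair_pre_digraph" where
  "dense_graph m = \<lparr>pverts = {..<6 + 2 * m},
     parcs = parcs (sparse_graph m) \<union> {(u, v). u < 6 + 2 * m \<and> v < 6 + 2 * m \<and> u \<noteq> v \<and> (u = 0 \<or> v = 0)}\<rparr>"

lemma half_edge_irrefl: "\<not> half_edge u u"
  by (auto simp: half_edge_def)

lemma pverts_sparse_graph [simp]: "pverts (sparse_graph m) = {..<6 + 2 * m}"
  by (simp add: sparse_graph_def)

lemma pverts_dense_graph [simp]: "pverts (dense_graph m) = {..<6 + 2 * m}"
  by (simp add: dense_graph_def)

lemma parcs_sparse_graph: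
  "(u, v) \<in> parcs (sparse_graph m) \<longleftrightarrow>
    u < 6 + 2 * m \<and> v < 6 + 2 * m \<and> (half_edge u v \<or> half_edge v u)"
  by (simp add: sparse_graph_def)

lemma parcs_dense_graph:
  "(u, v) \<in> parcs (dense_graph m) \<longleftrightarrow> u < 6 + 2 * m \<and> v < 6 + 2 * m \<and>
    (half_edge u v \<or> half_edge v u \<or> u \<noteq> v \<and> (u = 0 \<or> v = 0))"
  by (auto simp: dense_graph_def parcs_sparse_graph)

lemma finite_arcs_lessThan: "A \<subseteq> {..<n :: nat} \<times> {..<n} \<Longrightarrow> finite A"
  by (erule finite_subset) blast

lemma pair_graph_sparse_graph: "pair_graph (sparse_graph m)"
proof unfold_locales
  show "finite (parcs (sparse_graph m))"
    by (rule finite_arcs_lessThan[of _ "6 + 2 * m"]) (auto simp: parcs_sparse_graph)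
qed (auto simp: parcs_sparse_graph half_edge_irrefl symmetric_def intro!: symI)

lemma pair_graph_dense_graph: "pair_graph (dense_graph m)"
proof unfold_locales
  show "finite (parcs (dense_graph m))"
    by (rule finite_arcs_lessThan[of _ "6 + 2 * m"]) (auto simp: parcs_dense_graph)
qed (auto simp: parcs_dense_graph half_edge_irrefl symmetric_def intro!: symI)

interpretation sparse: pair_graph "sparse_graph m" for m
  by (rule pair_graph_sparse_graph)

interpretation dense: pair_graph "dense_graph m" for m
  by (rule pair_graph_dense_graph)

lemma spanning_sparse_dense: "spanning (with_proj (sparse_graph m)) (with_proj (dense_graph m))"
  unfolding spanning_def subgraph_def compatible_def
  using sparse.wf_digraph_axioms dense.wf_digraph_axioms
  by (auto simp: parcs_sparse_graph parcs_dense_graph)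

section \<open>Connectedness\<close>

text \<open>Since the arcs are symmetric, every \<open>u\<close> leads back to \<open>r\<close> and
  from there to \<open>v\<close>. This is the strong connectivity in terms of which
  \<open>connected\<close> is defined.\<close>

lemma connected_if_reachable_from:
  assumes "pair_graph G" "r \<in> pverts G" "\<And>v. v \<in> pverts G \<Longrightarrow> r \<rightarrow>\<^sup>*\<^bsub>with_proj G\<^esub> v"
  shows "Digraph_Component.connected (with_proj G)"
proof -
  interpret pair_graph G by fact
  have "strongly_connected (mk_symmetric (with_proj G))"
  proof
    show "verts (with_proj (mk_symmetric (with_proj G))) \<noteq> {}"
      using assms(2) by (auto simp: mk_symmetric_def)
    fix u v
    assume "u \<in> verts (with_proj (mk_symmetric (with_proj G)))"
      "v \<in> verts (with_proj (mk_symmetric (with_proj G)))"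
    then have "r \<rightarrow>\<^sup>*\<^bsub>with_proj G\<^esub> u" "r \<rightarrow>\<^sup>*\<^bsub>with_proj G\<^esub> v"
      using assms(3) by (auto simp: mk_symmetric_def)
    then have "u \<rightarrow>\<^sup>*\<^bsub>with_proj G\<^esub> v"
      using symmetric_reachable[OF sym_arcs] reachable_trans by blast
    then show "u \<rightarrow>\<^sup>*\<^bsub>with_proj (mk_symmetric (with_proj G))\<^esub> v"
      by (rule reachable_mk_symmetricI)
  qed
  then show ?thesis
    by (simp add: Digraph_Component.connected_def)
qed

lemma connected_sparse_graph:
  assumes "m \<ge> 1"
  shows "Digraph_Component.connected (with_proj (sparse_graph m))"
proof (rule connected_if_reachable_from[OF pair_graph_sparse_graph])
  show "0 \<in> pverts (sparse_graph m)" by simp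
next
  let ?R = "\<lambda>u v. u \<rightarrow>\<^sup>*\<^bsub>with_proj (sparse_graph m)\<^esub> v"
  have step: "?R u v" if "?R u w" "half_edge w v \<or> half_edge v w"
    "w < 6 + 2 * m" "v < 6 + 2 * m" for u v w
    using that by (intro sparse.reachable_adj_trans[of m u w v]) (auto simp: parcs_sparse_graph)
  have root: "?R 0 0" by (simp add: sparse.reachable_refl)
  fix v assume "v \<in> pverts (sparse_graph m)"
  then have v: "v < 6 + 2 * m" by simp
  have nbr: "?R 0 v" if "half_edge 0 v" "v < 6 + 2 * m" for v
    using that root step[of 0 0 v] by auto
  \<comment> \<open>The neighbours of 5 are the even vertices from 6 on, so 5 is reached through 6,
    which exists because \<open>m\<close> is positive.\<close>
  have "?R 0 3" "?R 0 6"
    using assms nbr[of 3] nbr[of 6] by (auto simp: half_edge_def)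
  then have "?R 0 2" "?R 0 5"
    using assms step[of 0 3 2] step[of 0 6 5] by (auto simp: half_edge_def)
  moreover have "?R 0 v" if "6 \<le> v" "odd v"
    using \<open>?R 0 2\<close> that v step[of 0 2 v] by (auto simp: half_edge_def)
  moreover have "?R 0 v" if "v = 0 \<or> v = 1 \<or> v = 3 \<or> v = 4 \<or> 6 \<le> v \<and> even v"
    using that root v nbr[of v] by (auto simp: half_edge_def)
  moreover have "v = 2 \<or> v = 5 \<or> 6 \<le> v \<and> odd v \<or>
      v = 0 \<or> v = 1 \<or> v = 3 \<or> v = 4 \<or> 6 \<le> v \<and> even v"
    by presburger
  ultimately show "?R 0 v" by auto
qed

lemma connected_dense_graph:
  "Digraph_Component.connected (with_proj (dense_graph m))"
proof (rule connected_if_reachable_from[OF pair_graph_dense_graph])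
  show "0 \<in> pverts (dense_graph m)" by simp
next
  fix v assume "v \<in> pverts (dense_graph m)"
  then show "0 \<rightarrow>\<^sup>*\<^bsub>with_proj (dense_graph m)\<^esub> v"
    by (cases "v = 0") (auto simp: parcs_dense_graph dense.reachable_refl intro!: dense.reachable_adjI)
qed

section \<open>The sparse graphs are stackable\<close>

abbreviation core :: "nat \<Rightarrow> nat set" where
  "core h \<equiv> {0, 1, 2, 3, 4, 5, h, Suc h}"

text \<open>
  In the unions below the right operand carries the target, so that each union encodes the move
  of the stack gathered on the left operand onto that of the right operand.
\<close>

lemma gathers_core:
  assumes "6 \<le> h" "even h" "Suc h < 6 + 2 * m" and v: "v \<in> core h"
  shows "\<exists>n. gathers (sparse_graph m) (core h) n v"
proof -
  let ?G = "sparse_graph m" and ?S = "core h"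
  \<comment> \<open>\<open>T\<close> will be a nested union that spells out a schedule of moves; its
    equality with the core is left to \<open>blast\<close>.\<close>
  have gathersI: "\<exists>n. gathers ?G ?S n v" if "T = ?S" "gathers ?G T n v" for T n v
    using that by blast
  \<comment> \<open>The suffixes after the distance name the interior vertices of a shortest path,
    with i standing for \<open>Suc h\<close>.\<close>
  have dist1:
    "graph_dist ?G 0 1 = 1" "graph_dist ?G 0 3 = 1" "graph_dist ?G 0 4 = 1"
    "graph_dist ?G 1 0 = 1" "graph_dist ?G 2 3 = 1" "graph_dist ?G 2 (Suc h) = 1"
    "graph_dist ?G 3 0 = 1" "graph_dist ?G 3 2 = 1" "graph_dist ?G 4 0 = 1"
    "graph_dist ?G 4 h = 1" "graph_dist ?G 5 h = 1" "graph_dist ?G (Suc h) 2 = 1"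
    "graph_dist ?G (Suc h) h = 1" "graph_dist ?G h 4 = 1" "graph_dist ?G h 5 = 1"
    by (rule sparse.graph_dist_1I; use assms(1-3) in \<open>auto simp: parcs_sparse_graph half_edge_def\<close>)+
  have dist2_0:
    "graph_dist ?G 1 3 = 2" "graph_dist ?G 1 4 = 2" "graph_dist ?G 1 h = 2"
    "graph_dist ?G 3 1 = 2" "graph_dist ?G 3 h = 2" "graph_dist ?G 4 1 = 2"
    by (rule sparse.graph_dist_2I[of _ 0]; use assms(1-3) in \<open>auto simp: parcs_sparse_graph half_edge_def\<close>)+
  have dist2_h:
    "graph_dist ?G 4 5 = 2" "graph_dist ?G 4 (Suc h) = 2" "graph_dist ?G 5 0 = 2"
    "graph_dist ?G 5 4 = 2" "graph_dist ?G 5 (Suc h) = 2" "graph_dist ?G (Suc h) 0 = 2"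
    "graph_dist ?G (Suc h) 5 = 2"
    by (rule sparse.graph_dist_2I[of _ h]; use assms(1-3) in \<open>auto simp: parcs_sparse_graph half_edge_def\<close>)+
  have dist2_2:
    "graph_dist ?G (Suc h) 3 = 2"
    by (rule sparse.graph_dist_2I[of _ 2]; use assms(1-3) in \<open>auto simp: parcs_sparse_graph half_edge_def\<close>)+
  have dist2_i:
    "graph_dist ?G h 2 = 2"
    by (rule sparse.graph_dist_2I[of _ "Suc h"]; use assms(1-3) in \<open>auto simp: parcs_sparse_graph half_edge_def\<close>)+
  have dist3_0_h:
    "graph_dist ?G 1 (Suc h) = 3" "graph_dist ?G 3 5 = 3"
    by (rule sparse.graph_dist_3I[of _ 0 _ h]; use assms(1-3) in \<open>auto simp: parcs_sparse_graph half_edge_def\<close>)+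
  have dist3_i_h:
    "graph_dist ?G 2 4 = 3"
    by (rule sparse.graph_dist_3I[of _ "Suc h" _ h]; use assms(1-3) in \<open>auto simp: parcs_sparse_graph half_edge_def\<close>)+
  have dist3_0_3:
    "graph_dist ?G 4 2 = 3"
    by (rule sparse.graph_dist_3I[of _ 0 _ 3]; use assms(1-3) in \<open>auto simp: parcs_sparse_graph half_edge_def\<close>)+
  have dist3_h_0:
    "graph_dist ?G 5 1 = 3" "graph_dist ?G 5 3 = 3"
    by (rule sparse.graph_dist_3I[of _ h _ 0]; use assms(1-3) in \<open>auto simp: parcs_sparse_graph half_edge_def\<close>)+
  note dists = dist1 dist2_0 dist2_h dist2_2 dist2_i dist3_0_h dist3_i_h dist3_0_3 dist3_h_0
  \<comment> \<open>Read as a schedule: 1 moves onto 0; 2 moves onto \<open>Suc h\<close> and this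
    pair onto 0; then 3 and 4 move onto 0; finally \<open>h\<close> moves onto 5 and this pair onto
    0. Simplification turns vertex 1 into \<open>Suc 0\<close>, so the distance equations are
    unfolded to match.\<close>
  have gather_0: "\<exists>n. gathers ?G ?S n 0"
    by (rule gathersI[of "({h} \<union> {5}) \<union> ({4} \<union> ({3} \<union> (({2} \<union> {Suc h}) \<union> ({1} \<union> {0}))))"],
        blast, (rule gathers.intros | use assms(1-3) in \<open>force simp: dists[unfolded One_nat_def]\<close>)+)
  have gather_1: "\<exists>n. gathers ?G ?S n 1"
    by (rule gathersI[of "(({2} \<union> {Suc h}) \<union> {5}) \<union> (({h} \<union> {4}) \<union> (({0} \<union> {3}) \<union> {1}))"],
        blast, (rule gathers.intros | use assms(1-3) in \<open>force simp: dists[unfolded One_nat_def]\<close>)+)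
  have gather_2: "\<exists>n. gathers ?G ?S n 2"
    by (rule gathersI[of "({5} \<union> {h}) \<union> ((({0} \<union> {1}) \<union> {4}) \<union> ({3} \<union> ({Suc h} \<union> {2})))"],
        blast, (rule gathers.intros | use assms(1-3) in \<open>force simp: dists[unfolded One_nat_def]\<close>)+)
  have gather_3: "\<exists>n. gathers ?G ?S n 3"
    by (rule gathersI[of "(({h} \<union> {4}) \<union> {5}) \<union> (({2} \<union> {Suc h}) \<union> (({0} \<union> {1}) \<union> {3}))"],
        blast, (rule gathers.intros | use assms(1-3) in \<open>force simp: dists[unfolded One_nat_def]\<close>)+)
  have gather_4: "\<exists>n. gathers ?G ?S n 4"
    by (rule gathersI[of "({h} \<union> {5}) \<union> (({3} \<union> ({Suc h} \<union> {2})) \<union> (({0} \<union> {1}) \<union> {4}))"],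
        blast, (rule gathers.intros | use assms(1-3) in \<open>force simp: dists[unfolded One_nat_def]\<close>)+)
  have gather_5: "\<exists>n. gathers ?G ?S n 5"
    by (rule gathersI[of "({h} \<union> {4}) \<union> ((({0} \<union> {1}) \<union> {3}) \<union> (({2} \<union> {Suc h}) \<union> {5}))"],
        blast, (rule gathers.intros | use assms(1-3) in \<open>force simp: dists[unfolded One_nat_def]\<close>)+)
  have gather_h: "\<exists>n. gathers ?G ?S n h"
    by (rule gathersI[of "{5} \<union> ({4} \<union> (({2} \<union> {3}) \<union> ({Suc h} \<union> (({0} \<union> {1}) \<union> {h}))))"],
        blast, (rule gathers.intros | use assms(1-3) in \<open>force simp: dists[unfolded One_nat_def]\<close>)+)
  have gather_i: "\<exists>n. gathers ?G ?S n (Suc h)"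
    by (rule gathersI[of "({h} \<union> {5}) \<union> (({0} \<union> {4}) \<union> ((({2} \<union> {3}) \<union> {1}) \<union> {Suc h}))"],
        blast, (rule gathers.intros | use assms(1-3) in \<open>force simp: dists[unfolded One_nat_def]\<close>)+)
  show ?thesis
    using v gather_0 gather_1 gather_2 gather_3 gather_4 gather_5 gather_h gather_i by blast
qed

text \<open>Vertex \<open>k\<close> has distance 2 from 1, 3 and \<open>h\<close> (through 0) and
  from 2 (through \<open>Suc k\<close>); \<open>Suc k\<close> has distance 2 from 0, 4 and 5
  (through \<open>k\<close>) and from \<open>Suc h\<close> (through 2). The pair is stacked on
  whichever end suits the target.\<close>

lemma gathers_pair:
  assumes "6 \<le> k" "even k" "Suc k < 6 + 2 * m" "6 \<le> h" "even h" "Suc h < 6 + 2 * m" "k \<noteq> h"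
    and v: "v \<in> core h"
  shows "\<exists>x. gathers (sparse_graph m) {k, Suc k} 2 x \<and> graph_dist (sparse_graph m) x v = 2"
proof -
  let ?G = "sparse_graph m"
  have d: "graph_dist ?G k (Suc k) = 1" "graph_dist ?G (Suc k) k = 1"
    by (rule sparse.graph_dist_1I; use assms(1-7) in \<open>auto simp: parcs_sparse_graph half_edge_def\<close>)+
  have "gathers ?G ({k} \<union> {Suc k}) (1 + 1) (Suc k)" "gathers ?G ({Suc k} \<union> {k}) (1 + 1) k"
    by (rule gathers.intros | use assms(1-3) in \<open>force simp: d\<close>)+
  then have g: "gathers ?G {k, Suc k} 2 (Suc k)" "gathers ?G {k, Suc k} 2 k"
    by (simp_all add: insert_commute numeral_2_eq_2)
  have "graph_dist ?G k 1 = 2" "graph_dist ?G k 3 = 2" "graph_dist ?G k h = 2"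
    by (rule sparse.graph_dist_2I[of _ 0]; use assms(1-7) in \<open>auto simp: parcs_sparse_graph half_edge_def\<close>)+
  moreover have "graph_dist ?G k 2 = 2"
    by (rule sparse.graph_dist_2I[of _ "Suc k"]; use assms(1-7) in \<open>auto simp: parcs_sparse_graph half_edge_def\<close>)
  moreover have "graph_dist ?G (Suc k) 0 = 2" "graph_dist ?G (Suc k) 4 = 2" "graph_dist ?G (Suc k) 5 = 2"
    by (rule sparse.graph_dist_2I[of _ k]; use assms(1-7) in \<open>auto simp: parcs_sparse_graph half_edge_def\<close>)+
  moreover have "graph_dist ?G (Suc k) (Suc h) = 2"
    by (rule sparse.graph_dist_2I[of _ 2]; use assms(1-7) in \<open>auto simp: parcs_sparse_graph half_edge_def\<close>)
  ultimately show ?thesis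
    using v g by blast
qed

text \<open>Each surplus pair moves straight onto \<open>v\<close>, so the pairs can be merged with
  the core schedule one by one.\<close>

lemma gathers_core_Un_pairs:
  assumes h: "6 \<le> h" "even h" "Suc h < 6 + 2 * m" and v: "v \<in> core h"
    and "finite K" "K \<subseteq> {k. 6 \<le> k \<and> even k \<and> Suc k < 6 + 2 * m \<and> k \<noteq> h}"
  shows "\<exists>n. gathers (sparse_graph m) ((\<Union>k\<in>K. {k, Suc k}) \<union> core h) n v"
  using assms(5,6)
proof induction
  case empty
  show ?case using gathers_core[OF h v] by simp
next
  case (insert k K)
  let ?T = "(\<Union>k\<in>K. {k, Suc k}) \<union> core h"
  from insert obtain n where n: "gathers (sparse_graph m) ?T n v" by auto
  from insert.prems h v obtain x where x: "gathers (sparse_graph m) {k, Suc k} 2 x"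
      "graph_dist (sparse_graph m) x v = 2"
    using gathers_pair[of k m h v] by auto
  have "even k" using insert.prems by simp
  have "\<forall>j\<in>insert h K. even j \<and> j \<noteq> k"
    using insert h by auto
  \<comment> \<open>All first entries are even, so distinct pairs cannot overlap.\<close>
  then have disj: "\<forall>j\<in>insert h K. Suc k \<noteq> j \<and> Suc j \<noteq> k \<and> k \<noteq> j"
    using \<open>even k\<close> even_Suc by blast
  have "{k, Suc k} \<inter> ?T = {}"
    using disj insert.prems by auto
  from gathers.merge[OF x(1) n this x(2)]
  have "gathers (sparse_graph m) ({k, Suc k} \<union> ?T) (2 + n) v" .
  moreover have "{k, Suc k} \<union> ?T = (\<Union>k\<in>insert k K. {k, Suc k}) \<union> core h"
    by blast
  ultimately show ?case by metis
qed

lemma stackable_sparse_graph: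
  assumes "m \<ge> 1"
  shows "stackable (sparse_graph m)"
  unfolding stackable_def
proof
  fix v assume "v \<in> pverts (sparse_graph m)"
  then have v: "v < 6 + 2 * m" by simp
  \<comment> \<open>The core uses the pair containing \<open>v\<close> if there is one, and
    otherwise the pair (6, 7), which exists because \<open>m\<close> is positive.\<close>
  define h where "h = (if v < 6 then 6 else 2 * (v div 2))"
  \<comment> \<open>An even number below an even bound leaves room for its successor.\<close>
  have "2 * (v div 2) < 5 + 2 * m"
    using v by presburger
  then have h: "6 \<le> h" "even h" "Suc h < 6 + 2 * m"
    using assms by (auto simp: h_def)
  have vh: "v \<in> core h"
    by (auto simp: h_def)
  define K where "K = {k. 6 \<le> k \<and> even k \<and> Suc k < 6 + 2 * m \<and> k \<noteq> h}"
  have "finite K"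
    by (rule finite_subset[of _ "{..<6 + 2 * m}"]) (auto simp: K_def)
  then obtain n where "gathers (sparse_graph m) ((\<Union>k\<in>K. {k, Suc k}) \<union> core h) n v"
    using gathers_core_Un_pairs[OF h vh, of K] by (auto simp: K_def)
  moreover have "(\<Union>k\<in>K. {k, Suc k}) \<union> core h = {..<6 + 2 * m}"
  proof
    show "(\<Union>k\<in>K. {k, Suc k}) \<union> core h \<subseteq> {..<6 + 2 * m}"
      using h by (auto simp: K_def)
    show "{..<6 + 2 * m} \<subseteq> (\<Union>k\<in>K. {k, Suc k}) \<union> core h"
    proof
      fix u assume u: "u \<in> {..<6 + 2 * m}"
      let ?k = "2 * (u div 2)"
      have "u = ?k \<or> u = Suc ?k" by presburger
      moreover have "?k \<in> K" if "6 \<le> u" "?k \<noteq> h"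
      proof -
        have "2 * (u div 2) < 5 + 2 * m"
          using u by simp presburger
        then show ?thesis using that by (auto simp: K_def)
      qed
      moreover have "u < 6 \<Longrightarrow> u \<in> core h" by auto
      ultimately consider "u \<in> core h" | "?k \<in> K" "u \<in> {?k, Suc ?k}"
        by (cases "u < 6"; cases "?k = h") auto
      then show "u \<in> (\<Union>k\<in>K. {k, Suc k}) \<union> core h"
        by cases blast+
    qed
  qed
  ultimately show "stackable_at (sparse_graph m) v"
    using stackable_at_if_gathers[of "sparse_graph m" n v] by simp
qed

section \<open>The dense graphs are not stackable\<close>

text \<open>Weight 1 marks the independent set of the dense graph, so no arc joins two vertices of
  weight 1.\<close>

definition weight :: "nat \<Rightarrow> int" where
  "weight v = (if v = 0 \<or> v = 2 \<or> 6 \<le> v \<and> even v then - 1 else 1)"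

text \<open>A potential that counts only the vertices other than the target 1 that still carry a
  single cup. It is 1 at the start and would be 0 with all cups on 1.\<close>

definition excess :: "nat \<Rightarrow> (nat \<Rightarrow> nat) \<Rightarrow> int" where
  "excess m c = (\<Sum>v<6 + 2 * m. if v \<noteq> 1 \<and> c v = 1 then weight v else 0)"

text \<open>A stack that can never be moved again in the dense graph and does not lie on the target 1.\<close>

definition stuck :: "(nat \<Rightarrow> nat) \<Rightarrow> bool" where
  "stuck c \<longleftrightarrow> (\<exists>v. v \<noteq> 1 \<and> c v \<ge> 3) \<or> c 0 \<ge> 2"

lemma sum_fun_upd2_zero:
  fixes f :: "'a \<Rightarrow> 'b::ab_group_add"
  assumes "finite A" "x \<in> A" "y \<in> A" "x \<noteq> y"
  shows "sum (f(x := 0, y := 0)) A = sum f A - f x - f y"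
proof -
  have "sum (f(x := 0, y := 0)) A = sum (f(x := 0, y := 0)) (A - {x} - {y})"
    using assms by (intro sum.mono_neutral_right) auto
  also have "\<dots> = sum f (A - {x} - {y})"
    by (intro sum.cong) auto
  also have "\<dots> = sum f A - f x - f y"
    using assms by (simp add: sum.remove[of A x] sum.remove[of "A - {x}" y])
  finally show ?thesis .
qed

text \<open>After the move \<open>x\<close> is empty and \<open>y\<close> carries at least two cups,
  so both drop out of the sum.\<close>

lemma excess_move:
  assumes "x < 6 + 2 * m" "y < 6 + 2 * m" "x \<noteq> y" "c x \<ge> 1" "c y \<ge> 1"
  shows "excess m (c(x := 0, y := c y + c x)) = excess m c
    - (if x \<noteq> 1 \<and> c x = 1 then weight x else 0) - (if y \<noteq> 1 \<and> c y = 1 then weight y else 0)"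
proof -
  let ?f = "\<lambda>v. if v \<noteq> 1 \<and> c v = 1 then weight v else 0"
  have "excess m (c(x := 0, y := c y + c x)) = sum (?f(x := 0, y := 0)) {..<6 + 2 * m}"
    unfolding excess_def using assms by (intro sum.cong) auto
  also have "\<dots> = sum ?f {..<6 + 2 * m} - ?f x - ?f y"
    using assms by (intro sum_fun_upd2_zero) auto
  finally show ?thesis by (simp add: excess_def)
qed

lemma excess_initial: "excess m (initial_cups (dense_graph m)) = 1"
proof -
  have "(\<Sum>v<6 + 2 * m. if v \<noteq> 1 then weight v else 0) = 1"
  proof (induction m)
    \<comment> \<open>Vertices 0 and 2 contribute -1 each, while 3, 4 and 5 contribute 1 each. Every
      further pair cancels.\<close>
    case 0
    show ?case by (simp add: weight_def eval_nat_numeral)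
  next
    case (Suc m)
    have "6 + 2 * Suc m = Suc (Suc (6 + 2 * m))" by simp
    then show ?case
      using Suc by (simp only: sum.lessThan_Suc) (simp add: weight_def)
  qed
  moreover have "excess m (initial_cups (dense_graph m)) =
      (\<Sum>v<6 + 2 * m. if v \<noteq> 1 then weight v else 0)"
    unfolding excess_def by (intro sum.cong) (auto simp: initial_cups_def)
  ultimately show ?thesis by simp
qed

text \<open>Vertex 0 is adjacent to all others. Hence stacks of three or more never move, a single
  cup moves along an arc, and only a single cup can leave 0.\<close>

lemma graph_dist_dense_le_2:
  assumes "x < 6 + 2 * m" "y < 6 + 2 * m" "x \<noteq> y"
  shows "graph_dist (dense_graph m) x y \<le> 2"
    and "graph_dist (dense_graph m) x y = 1 \<Longrightarrow> (x, y) \<in> parcs (dense_graph m)"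
    and "x = 0 \<Longrightarrow> graph_dist (dense_graph m) x y = 1"
proof -
  have "\<exists>k\<le>2. walk_of_length (dense_graph m) k x y"
  proof (cases "x = 0 \<or> y = 0")
    case True
    then have "(x, y) \<in> parcs (dense_graph m)"
      using assms by (auto simp: parcs_dense_graph)
    then show ?thesis
      by (intro exI[of _ "Suc 0"]) (simp add: dense.walk_of_length_1)
  next
    case False
    then have "(x, 0) \<in> parcs (dense_graph m)" "(0, y) \<in> parcs (dense_graph m)"
      using assms by (auto simp: parcs_dense_graph)
    then show ?thesis
      by (intro exI[of _ "Suc (Suc 0)"])
        (auto simp: dense.walk_of_length_1 dense.walk_of_length_Suc[of _ "Suc 0"])
  qed
  then obtain k where k: "k \<le> 2" "walk_of_length (dense_graph m) k x y" by blast
  then show "graph_dist (dense_graph m) x y \<le> 2"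
    using dense.graph_dist_le le_trans by blast
  show "(x, y) \<in> parcs (dense_graph m)" if "graph_dist (dense_graph m) x y = 1"
    using dense.walk_of_length_graph_dist[OF k(2)] that by (simp add: dense.walk_of_length_1)
  show "graph_dist (dense_graph m) x y = 1" if "x = 0"
    using assms that by (intro dense.graph_dist_1I) (auto simp: parcs_dense_graph)
qed

text \<open>A stuck stack never moves and can only grow. While there is none, a move either creates
  one or takes a total weight of at most 0 out of \<open>excess\<close>.\<close>

lemma stuck_or_excess_move:
  assumes "cup_move (dense_graph m) c c'" "stuck c \<or> excess m c \<ge> 1"
  shows "stuck c' \<or> excess m c' \<ge> 1"
proof (rule ccontr)
  assume contra: "\<not> ?thesis"
  obtain x y where xy: "x < 6 + 2 * m" "y < 6 + 2 * m" "x \<noteq> y" "c x \<ge> 1" "c y \<ge> 1"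
    and d: "graph_dist (dense_graph m) x y = c x" and c': "c' = c(x := 0, y := c y + c x)"
    using assms(1) by (auto simp: cup_move_def)
  note dist = graph_dist_dense_le_2[OF xy(1-3), unfolded d]
  have not_stuck': "v \<noteq> 1 \<Longrightarrow> c' v < 3" "c' 0 < 2" for v
    using contra by (auto simp: stuck_def not_le)
  have "\<not> stuck c"
  proof
    assume "stuck c"
    then obtain v where v: "v \<noteq> 1 \<and> c v \<ge> 3 \<or> v = 0 \<and> c v \<ge> 2"
      by (auto simp: stuck_def)
    then have "v \<noteq> x" using dist(1,3) by auto
    then have "c' v \<ge> c v" by (simp add: c')
    with v not_stuck' show False
      by (metis le_trans not_le)
  qed
  with assms(2) have "excess m c \<ge> 1" by simp
  moreover have "excess m c' < 1"
    using contra by simp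
  \<comment> \<open>Losing the invariant would require removing positive weight.\<close>
  ultimately have less: "(if x \<noteq> 1 \<and> c x = 1 then weight x else 0) +
      (if y \<noteq> 1 \<and> c y = 1 then weight y else 0) > 0"
    using excess_move[OF xy] c' by simp
  \<comment> \<open>Three cups on a vertex other than 1 would be stuck. So a stack of two can only
    go to 1, which removes no counted vertex, and a move to any other vertex joins two single
    cups.\<close>
  have y: "y = 1 \<or> c y + c x < 3"
    using not_stuck'(1)[of y] by (auto simp: c')
  show False
  proof (cases "c x = 1")
    case False
    with xy dist(1) have "c x = 2" by simp
    with y xy less show False by (auto split: if_splits)
  next
    case True
    then have arc: "(x, y) \<in> parcs (dense_graph m)" by (rule dist(2))
    have "y \<noteq> 0"
    proof
      assume "y = 0"
      with not_stuck'(2) xy show False by (simp add: c')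
    qed
    \<comment> \<open>Not both ends lie in the independent set; and \<open>x\<close> is not 1, whose
      only neighbour is 0.\<close>
    have "weight x + weight y \<le> 0 \<and> x \<noteq> 1" if "y \<noteq> 1"
      using arc that \<open>y \<noteq> 0\<close> by (auto simp: parcs_dense_graph half_edge_def weight_def)
    \<comment> \<open>A single cup reaches 1 only from 0, which has weight -1.\<close>
    moreover have "weight x \<le> 0" if "y = 1"
      using arc that by (auto simp: parcs_dense_graph half_edge_def weight_def)
    moreover have "y = 1 \<or> c y = 1"
      using y xy True by auto
    ultimately show False
      using less True by (auto split: if_splits)
  qed
qed

lemma not_stackable_dense_graph: "\<not> stackable (dense_graph m)"
proof
  assume "stackable (dense_graph m)"
  then have "stackable_at (dense_graph m) 1"
    by (simp add: stackable_def)
  then obtain c where c: "(cup_move (dense_graph m))\<^sup>*\<^sup>* (initial_cups (dense_graph m)) c"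
    and zero: "\<And>v. v \<noteq> 1 \<Longrightarrow> c v = 0"
    by (auto simp: stackable_at_def)
  from c have "stuck c \<or> excess m c \<ge> 1"
  proof induction
    case base
    show ?case by (simp add: excess_initial)
  next
    case (step c c')
    then show ?case using stuck_or_excess_move by blast
  qed
  moreover have "\<not> stuck c"
    using zero by (auto simp: stuck_def)
  moreover have "excess m c = 0"
    unfolding excess_def using zero by (intro sum.neutral) auto
  ultimately show False by simp
qed

section \<open>Infinitely many isomorphism classes\<close>

text \<open>The number of vertices is the invariant that separates the classes of the constructed
  pairs.\<close>

lemma graph_pair_iso_card_pverts:
  assumes "((G, H), (G', H')) \<in> graph_pair_iso"
  shows "card (pverts H') = card (pverts H)"
proof -
  from assms obtain f where f: "pre_digraph.digraph_isomorphism (with_proj H) f"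
    "with_proj H' = app_iso f (with_proj H)"
    by (auto simp: graph_pair_iso_def)
  from f(2) have "verts (with_proj H') = iso_verts f ` verts (with_proj H)"
    by (simp add: app_iso_def)
  moreover have "inj_on (iso_verts f) (pverts H)"
    using f(1) by (simp add: pre_digraph.digraph_isomorphism_def)
  ultimately show ?thesis
    by (simp add: card_image)
qed

theorem theorem5p3:
  shows "infinite ({(G :: nat pair_pre_digraph, H).
           pair_graph G \<and> pair_graph H \<and>
           Digraph_Component.connected (with_proj G) \<and> Digraph_Component.connected (with_proj H) \<and>
           spanning (with_proj G) (with_proj H) \<and>
           stackable G \<and> \<not> stackable H} // graph_pair_iso)" (is "infinite (?A // _)")
proof
  assume fin: "finite (?A // graph_pair_iso)"
  \<comment> \<open>The shift to \<open>Suc m\<close> ensures that at least one pair (h, i) is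
    present.\<close>
  define P where "P m = (sparse_graph (Suc m), dense_graph (Suc m))" for m
  have P: "P m \<in> ?A" for m
    using pair_graph_sparse_graph pair_graph_dense_graph connected_sparse_graph
      connected_dense_graph spanning_sparse_dense stackable_sparse_graph not_stackable_dense_graph
    by (simp add: P_def)
  have "inj (\<lambda>m. graph_pair_iso `` {P m})"
  proof (rule injI)
    fix m n
    assume "graph_pair_iso `` {P m} = graph_pair_iso `` {P n}"
    moreover have "(P n, P n) \<in> graph_pair_iso"
      using equiv_graph_pair_iso spanning_sparse_dense
      unfolding P_def equiv_def refl_on_def by blast
    ultimately have "(P m, P n) \<in> graph_pair_iso" by blast
    then have "card (pverts (dense_graph (Suc n))) = card (pverts (dense_graph (Suc m)))"
      unfolding P_def by (rule graph_pair_iso_card_pverts)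
    then show "m = n" by simp
  qed
  moreover have "range (\<lambda>m. graph_pair_iso `` {P m}) \<subseteq> ?A // graph_pair_iso"
    using quotientI[OF P] by blast
  ultimately show False
    using fin finite_subset range_inj_infinite by blast
qed

end
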